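(* For each real number $k>0$ there exists a constant $c_k>0$ (depending only on $k$) such that for each integer $r>1$, the upper asymptotic density of the set $\{n\in\mathbb{N}: S_r(n)\in\mathbb{N}\}$ is at most $c_k/r^k$.
   Context: $\mathbb{N}$ denotes the set of positive integers. For $r\in\mathbb{N}$, the function $S_r:\mathbb{N}\to\mathbb{Q}$ is defined by $S_r(n)=\sum_{k=0}^{n}\frac{k}{k+r}\binom{n}{k}$. The upper asymptotic density of a set $A\subseteq\mathbb{N}$ is $\limsup_{x\to\infty}\frac{1}{x}\#\{n\in A: n\le x\}$. *)

theory Defs
  imports "HOL-Analysis.Analysis"
begin

definition S :: "nat \<Rightarrow> nat \<Rightarrow> rat" where
  "S r n = (\<Sum>k=0..n. of_nat k / of_nat (k + r) * of_nat (n choose k))"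

(* The limsup is over real x tending to infinity and is taken in the extended reals,
   where it always exists. *)
definition upper_density :: "nat set \<Rightarrow> ereal" where
  "upper_density A = Limsup at_top (\<lambda>x::real. ereal (real (card {n \<in> A. real n \<le> x}) / x))"

end

theory Submission
  imports Defs "HOL-Number_Theory.Number_Theory"
begin

text \<open>
  For every \<open>r > 1\<close> the set in question has density zero, so the bound holds with constant 1 for
  every exponent. The reason is that an integer value forces a sieve condition on
  \<open>n + 1\<close> or \<open>n + 2\<close> by a set of primes whose reciprocals have a divergent sum.

  Write \<open>S r n = 2 ^ n - r * F r n\<close> with \<open>F r n = (\<Sum>k\<le>n. (n choose k) / (k + r))\<close>. Pascal's rule says
  that \<open>F (r + 1)\<close> is the forward difference of \<open>F r\<close>, and \<open>F 1 n = (2 ^ (n + 1) - 1) / (n + 1)\<close>, so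
  \<open>F r n\<close> is a combination with signed binomial coefficients of the fractions \<open>(2 ^ m - 1) / m\<close> for
  \<open>m = n + 1, \<dots>, n + r\<close>. A prime \<open>p > r\<close> divides at most one of these \<open>m\<close> and no binomial
  coefficient. If \<open>p\<close> divides \<open>m\<close> but not \<open>2 ^ m - 1\<close>, nothing cancels the pole, and \<open>S r n\<close> is not
  an integer (\<open>S_not_integer\<close>).

  If \<open>m\<close> is odd and \<open>p\<close> divides \<open>2 ^ m - 1\<close>, then 2 is a square modulo \<open>p\<close>, which is impossible for
  \<open>p\<close> congruent to 3 or 5 modulo 8 (\<open>prime_dvd_mersenne_imp_even\<close>). Since one of \<open>n + 1\<close>, \<open>n + 2\<close> is
  odd and \<open>r \<ge> 2\<close>, integrality of \<open>S r n\<close> implies that the odd one is coprime to every prime \<open>p > r\<close>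
  in these two classes (\<open>S_integer_imp_coprime\<close>).

  Numbers coprime to a modulus \<open>Q\<close> have density \<open>\<phi>(Q) / Q\<close>. This ratio becomes arbitrarily small for
  products \<open>Q\<close> of such primes, because the sum of \<open>1 / p\<close> over the primes \<open>p\<close> congruent to 3 or 5
  modulo 8 diverges (\<open>not_summable_nonresidue_weight\<close>). The divergence is obtained by counting, without
  L-functions: a number in one of the two classes always has a prime factor in one of them, so if
  the sum converged, large primes could not account for all the numbers in these classes that have
  no small prime factor of that kind.
\<close>

section \<open>Residues 3 and 5 modulo 8\<close>

text \<open>
  On the odd numbers this is the set where the quadratic character \<open>(2 / n)\<close> takes the value -1;
  it contains composite numbers as well as primes.
\<close>

definition nonresidue_class :: "nat set" where
  "nonresidue_class = {n. n mod 8 = 3 \<or> n mod 8 = 5}"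

lemma odd_if_nonresidue_class: "n \<in> nonresidue_class \<Longrightarrow> odd n"
  unfolding nonresidue_class_def mem_Collect_eq by presburger

lemma mult_mem_nonresidue_class_iff:
  assumes "odd a" "odd b"
  shows "a * b \<in> nonresidue_class \<longleftrightarrow> (a \<in> nonresidue_class) \<noteq> (b \<in> nonresidue_class)"
proof -
  have "a mod 8 = 1 \<or> a mod 8 = 3 \<or> a mod 8 = 5 \<or> a mod 8 = 7"
    "b mod 8 = 1 \<or> b mod 8 = 3 \<or> b mod 8 = 5 \<or> b mod 8 = 7"
    using assms by presburger+
  moreover have "(a * b) mod 8 = ((a mod 8) * (b mod 8)) mod 8"
    by (simp add: mod_mult_eq)
  ultimately show ?thesis
    unfolding nonresidue_class_def by auto
qed

text \<open>
  The product of two odd numbers outside the class is again outside, so a number in the class cannot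
  be a product of primes that all lie outside.
\<close>

lemma nonresidue_class_prime_factor:
  assumes "n \<in> nonresidue_class"
  shows "\<exists>p. prime p \<and> p \<in> nonresidue_class \<and> p dvd n"
  using assms
proof (induction n rule: less_induct)
  case (less n)
  have "n \<noteq> 1" using less.prems by (auto simp: nonresidue_class_def)
  then obtain p where p: "prime p" "p dvd n" using prime_factor_nat by blast
  then obtain m where m: "n = p * m" by blast
  have odd: "odd p" "odd m" using odd_if_nonresidue_class[OF less.prems] m by auto
  show ?case
  proof (cases "p \<in> nonresidue_class")
    case True
    then show ?thesis using p by blast
  next
    case False
    then have "m \<in> nonresidue_class"
      using mult_mem_nonresidue_class_iff[OF odd] less.prems m by auto
    moreover have "m < n"
      using m odd_pos[OF odd(2)] prime_gt_1_nat[OF p(1)] by simp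
    ultimately show ?thesis using less.IH m by (meson dvd_mult)
  qed
qed

text \<open>
  Infinite descent. If 2 is a square modulo \<open>p\<close>, it is the square of an odd \<open>y < p\<close>, and the
  cofactor \<open>k\<close> in \<open>y ^ 2 - 2 = p * k\<close> satisfies \<open>k < p\<close>. Since \<open>y ^ 2 - 2\<close> is 7 modulo 8, \<open>k\<close> lies in
  the class along with \<open>p\<close>, so it has a prime factor in the class, smaller than \<open>p\<close>, modulo which 2 is
  again a square.
\<close>

lemma two_not_square_mod_prime:
  fixes x :: nat
  assumes "prime p" "p \<in> nonresidue_class"
  shows "\<not> [x\<^sup>2 = 2] (mod p)"
  using assms
proof (induction p arbitrary: x rule: less_induct)
  case (less p)
  have "odd p" by (rule odd_if_nonresidue_class[OF less.prems(2)])
  show ?case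
  proof
    assume x: "[x\<^sup>2 = 2] (mod p)"
    have "p > 2" using less.prems by (cases "p = 2") (auto simp: nonresidue_class_def dest: prime_gt_1_nat)
    define z where "z = x mod p"
    \<comment> \<open>Negating a root modulo the odd prime changes its parity, so an odd root exists.\<close>
    define y where "y = (if odd z then z else p - z)"
    have z: "[z\<^sup>2 = 2] (mod p)" "z < p"
      using x \<open>p > 2\<close> by (auto simp: z_def cong_def power_mod)
    have "z \<noteq> 0"
    proof
      assume "z = 0"
      then have "[0 = 2] (mod p)" using z(1) by simp
      then show False using \<open>p > 2\<close> by (simp add: cong_def)
    qed
    have y: "odd y" "y < p"
      using z(2) \<open>odd p\<close> \<open>z \<noteq> 0\<close> by (auto simp: y_def)
    have "int p dvd (int y)\<^sup>2 - 2"
    proof -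
      have zz: "int p dvd (int z)\<^sup>2 - 2"
        using z(1) by (metis cong_iff_dvd_diff cong_int_iff of_nat_numeral of_nat_power)
      have "(int p - int z)\<^sup>2 - 2 = int p * (int p - 2 * int z) + ((int z)\<^sup>2 - 2)"
        by (simp add: power2_eq_square algebra_simps)
      then have "int p dvd (int p - int z)\<^sup>2 - 2"
        using zz by (metis dvd_add dvd_triv_left)
      then show ?thesis using zz z(2) by (auto simp: y_def of_nat_diff)
    qed
    moreover have "y \<noteq> 1"
      using calculation \<open>p > 2\<close> by auto
    moreover have "y\<^sup>2 \<ge> 9"
    proof -
      have "y \<ge> 3" using y(1) \<open>y \<noteq> 1\<close> by (cases "y = 2"; cases "y = 0") auto
      then have "y\<^sup>2 \<ge> 3\<^sup>2" by (rule power_mono) simp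
      then show ?thesis by simp
    qed
    moreover have "int (y\<^sup>2 - 2) = (int y)\<^sup>2 - 2"
      using \<open>y\<^sup>2 \<ge> 9\<close> by (simp add: of_nat_diff)
    ultimately have "p dvd y\<^sup>2 - 2"
      by (metis of_nat_dvd_iff)
    then obtain k where k: "y\<^sup>2 - 2 = p * k" by blast
    have "[y\<^sup>2 = 1] (mod 8)"
      using square_mod_8_eq_1_iff y(1) by blast
    then have y1: "y\<^sup>2 mod 8 = 1" unfolding cong_def by (rule trans) simp
    then have m7: "(y\<^sup>2 - 2) mod 8 = 7"
    proof -
      have "(w - 2) mod 8 = 7" if "w \<ge> 2" "w mod 8 = 1" for w :: nat
      proof -
        have "w = 8 * (w div 8) + 1" using mult_div_mod_eq[of 8 w] that(2) by simp
        moreover from this that(1) have "w div 8 \<noteq> 0" by (cases "w div 8 = 0") simp_all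
        ultimately have "w - 2 = 7 + 8 * (w div 8 - 1)" by linarith
        then show ?thesis by (metis mod_mult_self2 mod_less numeral_less_iff semiring_norm(76,78,80,81))
      qed
      moreover have "y\<^sup>2 \<ge> 2" using \<open>y\<^sup>2 \<ge> 9\<close> by (rule order_trans[rotated]) simp
      ultimately show ?thesis using y1 by blast
    qed
    have "odd k"
    proof -
      have "odd w" if "w mod 8 = 7" for w :: nat
        using that by presburger
      then have "odd (y\<^sup>2 - 2)" using m7 by blast
      then show ?thesis unfolding k by simp
    qed
    have "k \<in> nonresidue_class"
      using mult_mem_nonresidue_class_iff[OF \<open>odd p\<close> \<open>odd k\<close>] less.prems(2) m7 k
      by (auto simp: nonresidue_class_def)
    then obtain q where q: "prime q" "q \<in> nonresidue_class" "q dvd k"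
      using nonresidue_class_prime_factor by blast
    have "q < p"
    proof -
      have "k > 0" using \<open>odd k\<close> by (cases k) auto
      have "p * k < p * p"
        using k y(2) \<open>y\<^sup>2 \<ge> 9\<close> by (metis diff_le_self le_less_trans mult_strict_mono' power2_eq_square zero_le)
      then have "k < p" by simp
      then show ?thesis using dvd_imp_le[OF q(3) \<open>k > 0\<close>] by linarith
    qed
    have "[y\<^sup>2 = 2] (mod q)"
    proof -
      have "q dvd y\<^sup>2 - 2" unfolding k using q(3) by (rule dvd_mult)
      moreover have "2 \<le> y\<^sup>2" using \<open>y\<^sup>2 \<ge> 9\<close> by linarith
      ultimately show ?thesis by (metis cong_altdef_nat)
    qed
    then show False using less.IH[OF \<open>q < p\<close> q(1,2)] by blast
  qed
qed

text \<open>
  For odd \<open>m\<close>, the congruence \<open>2 ^ m = 1\<close> would make \<open>2 = 2 ^ (m + 1)\<close> a square modulo \<open>p\<close>.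
\<close>

lemma prime_dvd_mersenne_imp_even:
  assumes "prime p" "p \<in> nonresidue_class" "p dvd 2 ^ m - (1::nat)"
  shows "even m"
proof (rule ccontr)
  assume "odd m"
  then obtain l where l: "m = 2 * l + 1" by (auto elim: oddE)
  have "[2 ^ m = (1::nat)] (mod p)"
    using assms(3) by (metis cong_to_1'_nat cong_altdef_nat one_le_numeral one_le_power)
  then have "[2 * 2 ^ m = 2 * (1::nat)] (mod p)" by (rule cong_scalar_left)
  moreover have "2 * 2 ^ m = (2 ^ (l + 1) :: nat)\<^sup>2"
  proof -
    have "Suc m = (l + 1) * 2" using l by simp
    then show ?thesis by (metis power_Suc power_mult)
  qed
  ultimately show False using two_not_square_mod_prime[OF assms(1,2)] by (metis mult_1_right)
qed

section \<open>Counting in periodic sets\<close>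

lemma le_Suc_div_mult:
  fixes N Q :: nat
  assumes "Q > 0"
  shows "N \<le> (N div Q + 1) * Q"
  using div_mult_mod_eq[of N Q] mod_less_divisor[OF assms, of N]
  unfolding add_mult_distrib mult_1 by linarith

lemma coprime_add_self_iff: "coprime (n + Q) Q \<longleftrightarrow> coprime n Q" for n Q :: nat
  by (simp only: coprime_iff_gcd_eq_1 gcd_add1)

lemma card_periodic:
  fixes A :: "nat set"
  assumes "\<And>n. n + Q \<in> A \<longleftrightarrow> n \<in> A"
  shows "card (A \<inter> {0<..M * Q}) = M * card (A \<inter> {0<..Q})"
proof (induction M)
  case 0
  then show ?case by simp
next
  case (Suc M)
  have shift: "n + M * Q \<in> A \<longleftrightarrow> n \<in> A" for n
  proof (induction M)
    case (Suc M)
    have "n + Suc M * Q = (n + M * Q) + Q" by simp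
    then show ?case using assms Suc.IH by metis
  qed simp
  have split: "A \<inter> {0<..Suc M * Q} = (A \<inter> {0<..M * Q}) \<union> (\<lambda>n. n + M * Q) ` (A \<inter> {0<..Q})"
  proof -
    have "n \<in> (\<lambda>n. n + M * Q) ` (A \<inter> {0<..Q})" if "n \<in> A" "n > M * Q" "n \<le> Q + M * Q" for n
    proof (rule image_eqI)
      show "n = (n - M * Q) + M * Q" using that by simp
      show "n - M * Q \<in> A \<inter> {0<..Q}" using that shift[of "n - M * Q"] by auto
    qed
    then show ?thesis using shift by force
  qed
  have "card (A \<inter> {0<..Suc M * Q}) = card (A \<inter> {0<..M * Q}) + card ((\<lambda>n. n + M * Q) ` (A \<inter> {0<..Q}))"
    unfolding split by (rule card_Un_disjoint) auto
  also have "card ((\<lambda>n. n + M * Q) ` (A \<inter> {0<..Q})) = card (A \<inter> {0<..Q})"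
    by (rule card_image) simp
  finally show ?case using Suc.IH by simp
qed

section \<open>Divergence of the sum of reciprocals\<close>

definition nonresidue_weight :: "nat \<Rightarrow> real" where
  "nonresidue_weight p = (if prime p \<and> p \<in> nonresidue_class then 1 / real p else 0)"

lemma nonresidue_weight_nonneg: "nonresidue_weight p \<ge> 0"
  by (simp add: nonresidue_weight_def)

text \<open>
  Adding a power of 2 that is greater than 1 to the odd number \<open>q\<close> keeps it coprime to \<open>8 * q\<close>;
  adding 8 preserves the class modulo 8, and adding 4 interchanges the classes 1, 7 with 5, 3.
\<close>

lemma exists_coprime_nonresidue:
  fixes q :: nat
  assumes "odd q"
  shows "\<exists>u. u \<in> nonresidue_class \<and> coprime u (8 * q)"
proof -
  have cop: "coprime (q + 2 ^ k) (8 * q)" if "k > 0" for k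
  proof -
    have "coprime (2 ^ k) q" using assms by simp
    then have "coprime (q + 2 ^ k) q"
      by (metis add.commute coprime_iff_gcd_eq_1 gcd_add1)
    moreover have "coprime (q + 2 ^ k) (2 ^ 3)"
    proof -
      have "odd (q + 2 ^ k)" using assms that by simp
      then have "coprime (q + 2 ^ k) 2" by simp
      then show ?thesis by (metis coprime_power_right_iff)
    qed
    ultimately show ?thesis by simp
  qed
  show ?thesis
  proof (cases "q \<in> nonresidue_class")
    case True
    then have "q + 2 ^ 3 \<in> nonresidue_class" by (auto simp: nonresidue_class_def)
    then show ?thesis using cop[of 3] by (intro exI[of _ "q + 2 ^ 3"]) simp
  next
    case False
    then have "q + 2 ^ 2 \<in> nonresidue_class"
      using assms unfolding nonresidue_class_def by simp presburger
    then show ?thesis using cop[of 2] by (intro exI[of _ "q + 2 ^ 2"]) simp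
  qed
qed

lemma mod_mem_nonresidue_class_iff:
  assumes "8 dvd Q"
  shows "n mod Q \<in> nonresidue_class \<longleftrightarrow> n \<in> nonresidue_class"
  using assms by (simp add: nonresidue_class_def mod_mod_cancel)

text \<open>
  Multiplication by \<open>u\<close> permutes the units modulo \<open>Q\<close> and carries those outside the class into it.
\<close>

lemma card_residue_units_le:
  assumes "8 dvd Q" "Q > 0" "u \<in> nonresidue_class" "coprime u Q"
  shows "card ({t. coprime t Q \<and> t \<notin> nonresidue_class} \<inter> {0<..Q})
       \<le> card ({t. coprime t Q \<and> t \<in> nonresidue_class} \<inter> {0<..Q})"
proof (rule card_inj_on_le)
  have odd: "odd t" if "coprime t Q" for t
  proof
    assume "even t"
    moreover have "even Q" using assms(1) by auto
    ultimately show False using that coprime_common_divisor by fastforce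
  qed
  have lt: "t < Q" if "coprime t Q" "t \<le> Q" for t
  proof (rule ccontr)
    assume "\<not> t < Q"
    then have "t = Q" using that by simp
    then have "Q = 1" using that by simp
    then show False using assms(1) by simp
  qed
  show "inj_on (\<lambda>t. (t * u) mod Q) ({t. coprime t Q \<and> t \<notin> nonresidue_class} \<inter> {0<..Q})"
  proof (rule inj_onI)
    fix s t
    assume s: "s \<in> {t. coprime t Q \<and> t \<notin> nonresidue_class} \<inter> {0<..Q}"
      and t: "t \<in> {t. coprime t Q \<and> t \<notin> nonresidue_class} \<inter> {0<..Q}"
      and "(s * u) mod Q = (t * u) mod Q"
    then have "[s = t] (mod Q)"
      using cong_mult_rcancel_nat[OF assms(4)] by (simp add: cong_def)
    then show "s = t" using s t lt[of s] lt[of t] by (auto simp: cong_def)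
  qed
  show "(\<lambda>t. (t * u) mod Q) ` ({t. coprime t Q \<and> t \<notin> nonresidue_class} \<inter> {0<..Q})
    \<subseteq> {t. coprime t Q \<and> t \<in> nonresidue_class} \<inter> {0<..Q}"
  proof
    fix v assume "v \<in> (\<lambda>t. (t * u) mod Q) ` ({t. coprime t Q \<and> t \<notin> nonresidue_class} \<inter> {0<..Q})"
    then obtain t where t: "coprime t Q" "t \<notin> nonresidue_class" and v: "v = (t * u) mod Q" by blast
    have c: "coprime v Q" using t assms(2,4) by (simp add: v)
    have "v \<noteq> 0"
    proof
      assume "v = 0"
      then have "Q = 1" using c by simp
      then show False using assms(1) by simp
    qed
    moreover have "v \<in> nonresidue_class"
      using mult_mem_nonresidue_class_iff[OF odd[OF t(1)] odd[OF assms(4)]] t assms(3)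
        mod_mem_nonresidue_class_iff[OF assms(1)] by (simp add: v)
    moreover have "v \<le> Q" using assms(2) by (simp add: v less_imp_le)
    ultimately show "v \<in> {t. coprime t Q \<and> t \<in> nonresidue_class} \<inter> {0<..Q}"
      using c by simp
  qed
  show "finite ({t. coprime t Q \<and> t \<in> nonresidue_class} \<inter> {0<..Q})" by simp
qed

text \<open>
  Suppose the sum converges and choose \<open>K\<close> so that the tail from \<open>K\<close> on is below \<open>1/8\<close>. Let \<open>Q\<close> be 8
  times the product of the primes of the class below \<open>K\<close>, and let \<open>A\<close> and \<open>B\<close> be the numbers coprime to
  \<open>Q\<close> inside and outside the class, with \<open>\<alpha>\<close> elements of \<open>A\<close> per period. Every element of \<open>A\<close> is
  \<open>t * p\<close> with a prime \<open>p \<ge> K\<close> of the class and \<open>t\<close> in \<open>B\<close>. Up to \<open>M * Q\<close> there are \<open>M * \<alpha>\<close> elements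
  of \<open>A\<close>. For \<open>p < M\<close> the range of \<open>t\<close> is at least a full period long, so periodicity bounds the
  number of \<open>t\<close> by \<open>2 * M * \<alpha> / p\<close>, and these primes contribute at most \<open>M * \<alpha> / 4\<close>. For \<open>p \<ge> M\<close> the
  trivial bound \<open>M * Q / p\<close> is enough: \<open>Q\<close> is fixed, and \<open>M\<close> can be taken so large that the tail from
  \<open>M\<close> on is below \<open>1 / (4 * Q)\<close>. Together fewer than all elements of \<open>A\<close> are reached.
\<close>

lemma not_summable_nonresidue_weight: "\<not> summable nonresidue_weight"
proof
  assume "summable nonresidue_weight"
  then have tail: "\<exists>N. \<forall>m\<ge>N. \<forall>n. sum nonresidue_weight {m..<n} < e" if "e > 0" for e
    using that unfolding summable_Cauchy by (simp add: abs_of_nonneg sum_nonneg nonresidue_weight_nonneg)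
  obtain K where K: "\<And>n. sum nonresidue_weight {K..<n} < 1 / 8"
    using tail[of "1/8"] by auto
  define q where "q = (\<Prod>p | p < K \<and> prime p \<and> p \<in> nonresidue_class. p)"
  define Q where "Q = 8 * q"
  have "odd q"
    unfolding q_def by (rule ccontr) (auto simp: prime_dvd_prod_iff dest!: odd_if_nonresidue_class)
  then have "q > 0" by (cases q) auto
  have Q: "8 dvd Q" "Q > 0" using \<open>q > 0\<close> by (auto simp: Q_def)
  define A where "A = {t. coprime t Q \<and> t \<in> nonresidue_class}"
  define B where "B = {t. coprime t Q \<and> t \<notin> nonresidue_class}"
  define \<alpha> where "\<alpha> = card (A \<inter> {0<..Q})"
  have period: "n + Q \<in> nonresidue_class \<longleftrightarrow> n \<in> nonresidue_class" for n
    using mod_mem_nonresidue_class_iff[OF Q(1), of "n + Q"] mod_mem_nonresidue_class_iff[OF Q(1), of n] by simp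
  have periodAB: "n + Q \<in> A \<longleftrightarrow> n \<in> A" "n + Q \<in> B \<longleftrightarrow> n \<in> B" for n
    using period by (auto simp: A_def B_def coprime_add_self_iff)
  obtain u where u: "u \<in> nonresidue_class" "coprime u Q"
    using exists_coprime_nonresidue[OF \<open>odd q\<close>] Q_def by blast
  have \<beta>\<alpha>: "card (B \<inter> {0<..Q}) \<le> \<alpha>"
    unfolding \<alpha>_def A_def B_def by (rule card_residue_units_le[OF Q u])
  have "\<alpha> > 0"
  proof -
    have "u mod Q \<in> A"
      using u Q mod_mem_nonresidue_class_iff[OF Q(1), of u] by (simp add: A_def)
    moreover have "u mod Q \<noteq> 0" using calculation by (auto simp: A_def nonresidue_class_def)
    ultimately have "u mod Q \<in> A \<inter> {0<..Q}" using Q by (simp add: less_imp_le)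
    then show ?thesis unfolding \<alpha>_def by (subst card_gt_0_iff) auto
  qed
  obtain M0 where M0: "\<And>m n. m \<ge> M0 \<Longrightarrow> sum nonresidue_weight {m..<n} < 1 / (4 * real Q)"
    using tail[of "1 / (4 * real Q)"] Q by auto
  define M where "M = max K M0 + 1"
  have M: "M \<ge> K" "M \<ge> M0" "M > 0" by (auto simp: M_def)
  define X where "X = M * Q"
  define PP where "PP = {p \<in> {K..<X + 1}. prime p \<and> p \<in> nonresidue_class}"
  define C where "C p = {t \<in> B. t * p \<le> X}" for p
  have "0 \<notin> B" using Q by (auto simp: B_def)
  have Csub: "C p \<subseteq> {0<..X div p}" if "p > 0" for p
    using that \<open>0 \<notin> B\<close> by (auto simp: C_def less_eq_div_iff_mult_less_eq intro: gr0I)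
  have Cfin: "finite (C p)" if "p > 0" for p
    using finite_subset[OF Csub[OF that]] by simp
  \<comment> \<open>A prime of the class below \<open>K\<close> divides \<open>Q\<close>, so it cannot divide an element of \<open>A\<close>.\<close>
  have cover: "A \<inter> {0<..X} \<subseteq> (\<Union>p\<in>PP. (\<lambda>t. t * p) ` C p)"
  proof
    fix n assume n: "n \<in> A \<inter> {0<..X}"
    then obtain p where p: "prime p" "p \<in> nonresidue_class" "p dvd n"
      using nonresidue_class_prime_factor[of n] by (auto simp: A_def)
    then obtain t where t: "n = t * p" by (metis dvdE mult.commute)
    have "p \<ge> K"
    proof (rule ccontr)
      assume "\<not> p \<ge> K"
      then have "p dvd q" unfolding q_def using p by (intro dvd_prodI) auto
      then have "p dvd Q" by (simp add: Q_def)
      then have "is_unit p" using n p(3) coprime_common_divisor[of n Q p] by (simp add: A_def)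
      then show False using p(1) by simp
    qed
    moreover have "p \<le> X" using n p(3) by (auto dest: dvd_imp_le)
    ultimately have "p \<in> PP" using p by (simp add: PP_def)
    have "odd (t * p)" using odd_if_nonresidue_class[of n] n t by (simp add: A_def)
    then have "odd p" "odd t" by simp_all
    then have "t \<in> C p"
      using n t p(2) mult_mem_nonresidue_class_iff[of t p] by (auto simp: A_def B_def C_def)
    then show "n \<in> (\<Union>p\<in>PP. (\<lambda>t. t * p) ` C p)" using t \<open>p \<in> PP\<close> by blast
  qed
  have "card (A \<inter> {0<..X}) \<le> (\<Sum>p\<in>PP. card (C p))"
  proof -
    have fin: "finite PP" by (simp add: PP_def)
    have pos: "p > 0" if "p \<in> PP" for p using that by (auto simp: PP_def intro: prime_gt_0_nat)
    have "card (A \<inter> {0<..X}) \<le> card (\<Union>p\<in>PP. (\<lambda>t. t * p) ` C p)"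
      using fin pos Cfin by (intro card_mono[OF _ cover]) auto
    also have "\<dots> \<le> (\<Sum>p\<in>PP. card ((\<lambda>t. t * p) ` C p))" by (rule card_UN_le[OF fin])
    also have "\<dots> \<le> (\<Sum>p\<in>PP. card (C p))" using pos Cfin by (intro sum_mono card_image_le) auto
    finally show ?thesis .
  qed
  then have "real M * real \<alpha> \<le> (\<Sum>p\<in>PP. real (card (C p)))"
    using card_periodic[of Q A M, OF periodAB(1)] unfolding X_def \<alpha>_def
    by (metis of_nat_le_iff of_nat_mult of_nat_sum)
  also have "\<dots> \<le> (\<Sum>p\<in>PP. if p < M then 2 * M * \<alpha> * nonresidue_weight p else M * Q * nonresidue_weight p)"
  proof (rule sum_mono)
    fix p assume "p \<in> PP"
    then have p: "p > 0" and w: "nonresidue_weight p = 1 / p"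
      by (auto simp: PP_def nonresidue_weight_def prime_gt_0_nat)
    show "real (card (C p)) \<le> (if p < M then 2 * M * \<alpha> * nonresidue_weight p else M * Q * nonresidue_weight p)"
    proof (cases "p < M")
      case True
      have "C p \<subseteq> B \<inter> {0<..(M div p + 1) * Q}"
      proof
        fix t assume t: "t \<in> C p"
        have "M \<le> (M div p + 1) * p"
          by (rule le_Suc_div_mult[OF p])
        then have "t * p \<le> ((M div p + 1) * p) * Q"
          using t order_trans[OF _ mult_right_mono[of M _ Q]] by (simp add: C_def X_def)
        then have "t * p \<le> ((M div p + 1) * Q) * p" by (simp only: mult_ac)
        then have "t \<le> (M div p + 1) * Q" using p by (simp only: mult_le_cancel2)
        then show "t \<in> B \<inter> {0<..(M div p + 1) * Q}" using t Csub[OF p] by (auto simp: C_def)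
      qed
      then have "card (C p) \<le> card (B \<inter> {0<..(M div p + 1) * Q})" by (intro card_mono) auto
      also have "\<dots> \<le> (M div p + 1) * \<alpha>"
        unfolding card_periodic[of Q B, OF periodAB(2)] using \<beta>\<alpha> by (rule mult_le_mono2)
      finally have "real (card (C p)) \<le> (real (M div p) + 1) * \<alpha>"
        by (metis of_nat_1 of_nat_add of_nat_le_iff of_nat_mult)
      also have "\<dots> \<le> (M / p + M / p) * \<alpha>"
        using True p by (intro mult_right_mono add_mono of_nat_div_le_of_nat) auto
      finally show ?thesis using True w by (simp add: field_simps)
    next
      case False
      have "card (C p) \<le> X div p" using card_mono[OF _ Csub[OF p]] by simp
      then have "real (card (C p)) \<le> real (X div p)" by simp
      also have "\<dots> \<le> real X / real p" by (rule of_nat_div_le_of_nat)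
      finally have "real (card (C p)) \<le> real X / real p" .
      then show ?thesis using False w by (simp add: X_def)
    qed
  qed
  also have "\<dots> \<le> (\<Sum>p=K..<X + 1. if p < M then 2 * M * \<alpha> * nonresidue_weight p else M * Q * nonresidue_weight p)"
    by (rule sum_mono2) (auto simp: PP_def nonresidue_weight_nonneg)
  also have "\<dots> = (\<Sum>p=K..<M. 2 * M * \<alpha> * nonresidue_weight p) + (\<Sum>p=M..<X + 1. M * Q * nonresidue_weight p)"
  proof -
    have "M \<le> X + 1" using Q by (simp add: X_def le_SucI)
    then show ?thesis
      by (subst sum.atLeastLessThan_concat[OF M(1), symmetric]) (auto intro!: arg_cong2[of _ _ _ _ "(+)"] sum.cong)
  qed
  also have "\<dots> = 2 * M * \<alpha> * sum nonresidue_weight {K..<M} + M * Q * sum nonresidue_weight {M..<X + 1}"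
    by (simp only: sum_distrib_left)
  also have "\<dots> \<le> 2 * M * \<alpha> * (1 / 8) + M * Q * (1 / (4 * Q))"
    using K[of M] M0[OF M(2), of "X + 1"] by (intro add_mono mult_left_mono) auto
  \<comment> \<open>Since \<open>\<alpha> \<ge> 1\<close>, the contribution \<open>M / 4\<close> of the large primes is at most \<open>M * \<alpha> / 4\<close>.\<close>
  also have "\<dots> = M * \<alpha> / 4 + M / 4" using Q by (simp add: field_simps)
  also have "\<dots> \<le> M * \<alpha> / 2"
  proof -
    have "real M * 1 \<le> real M * real \<alpha>" using \<open>\<alpha> > 0\<close> by (intro mult_left_mono) auto
    then show ?thesis by (simp add: field_simps)
  qed
  finally show False using M(3) \<open>\<alpha> > 0\<close> by (simp add: mult_le_0_iff)
qed

section \<open>A modulus with small totient ratio\<close>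

lemma totient_prod_primes:
  assumes "finite F" "\<And>p. p \<in> F \<Longrightarrow> prime (p::nat)"
  shows "real (totient (\<Prod>F)) = real (\<Prod>F) * (\<Prod>p\<in>F. 1 - 1 / real p)"
  using assms
proof (induction F rule: finite_induct)
  case empty
  then show ?case by simp
next
  case (insert p F)
  have p: "prime p" using insert.prems by simp
  have "coprime p (\<Prod>F)"
    using insert by (intro prod_coprime_right) (auto intro: primes_coprime)
  then have "real (totient (p * \<Prod>F)) = real (totient p) * real (totient (\<Prod>F))"
    by (simp add: totient_mult_coprime)
  moreover have "real (totient p) = p * (1 - 1 / p)"
    using p prime_gt_0_nat[OF p] by (simp add: totient_prime of_nat_diff field_simps)
  moreover have "real (totient (\<Prod>F)) = real (\<Prod>F) * (\<Prod>p\<in>F. 1 - 1 / real p)"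
    using insert by simp
  ultimately show ?case using insert.hyps by (simp add: mult_ac)
qed

text \<open>
  For primes, \<open>1 - 1 / p \<le> exp (- 1 / p)\<close>, so divergence of the sum of reciprocals makes the product
  of the factors \<open>1 - 1 / p\<close> arbitrarily small, even after the primes up to \<open>r\<close> are discarded.
\<close>

lemma exists_sieving_modulus:
  fixes \<epsilon> :: real
  assumes "\<epsilon> > 0"
  shows "\<exists>Q. Q > 0 \<and> (\<forall>p. prime p \<longrightarrow> p dvd Q \<longrightarrow> p > r \<and> p \<in> nonresidue_class) \<and>
    real (totient Q) \<le> \<epsilon> * real Q"
proof -
  \<comment> \<open>The primes up to \<open>r\<close> contribute at most \<open>r + 1\<close>; the rest has to exceed \<open>ln (1 / \<epsilon>)\<close>.\<close>
  have "\<not> (\<forall>n. sum nonresidue_weight {..<n} \<le> real (r + 1) + ln (1 / \<epsilon>))"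
    using not_summable_nonresidue_weight summableI_nonneg_bounded[of nonresidue_weight] nonresidue_weight_nonneg by blast
  then obtain N where N: "sum nonresidue_weight {..<N} > real (r + 1) + ln (1 / \<epsilon>)"
    by (auto simp only: not_all not_le)
  define F where "F = {p \<in> {r<..<N}. prime p \<and> p \<in> nonresidue_class}"
  have F: "finite F" "\<And>p. p \<in> F \<Longrightarrow> prime p" by (auto simp: F_def)
  have "sum nonresidue_weight {..<N} \<le> sum nonresidue_weight ({..r} \<union> {r<..<N})"
    by (rule sum_mono2) (auto simp: nonresidue_weight_nonneg)
  also have "\<dots> = sum nonresidue_weight {..r} + sum nonresidue_weight {r<..<N}"
    by (rule sum.union_disjoint) auto
  also have "sum nonresidue_weight {r<..<N} = sum nonresidue_weight F"
    by (rule sum.mono_neutral_right) (auto simp: F_def nonresidue_weight_def)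
  also have "sum nonresidue_weight {..r} \<le> (\<Sum>p\<in>{..r}. 1)"
  proof (rule sum_mono)
    show "nonresidue_weight p \<le> 1" for p
      by (cases "p = 0") (auto simp: nonresidue_weight_def)
  qed
  finally have big: "sum nonresidue_weight F > ln (1 / \<epsilon>)" using N by simp
  have "(\<Prod>p\<in>F. 1 - 1 / real p) \<le> (\<Prod>p\<in>F. exp (- nonresidue_weight p))"
  proof (rule prod_mono)
    fix p assume "p \<in> F"
    then have p: "p > 1" and w: "nonresidue_weight p = 1 / p"
      using prime_gt_1_nat[of p] by (auto simp: F_def nonresidue_weight_def)
    show "0 \<le> 1 - 1 / real p \<and> 1 - 1 / real p \<le> exp (- nonresidue_weight p)"
      using p exp_ge_add_one_self[of "- (1 / p)"] by (simp add: w)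
  qed
  also have "\<dots> = exp (- sum nonresidue_weight F)"
    by (simp add: exp_sum[OF F(1)] sum_negf[symmetric])
  also have "\<dots> \<le> exp (- ln (1 / \<epsilon>))" using big by simp
  also have "\<dots> = \<epsilon>" using assms by (simp add: ln_div)
  finally have small: "(\<Prod>p\<in>F. 1 - 1 / real p) \<le> \<epsilon>" .
  show ?thesis
  proof (intro exI[of _ "\<Prod>F"] conjI allI impI)
    show "\<Prod>F > 0" using F by (auto intro: prod_pos prime_gt_0_nat)
    show "real (totient (\<Prod>F)) \<le> \<epsilon> * real (\<Prod>F)"
      using totient_prod_primes[OF F] mult_left_mono[OF small, of "real (\<Prod>F)"]
      by (simp only: mult.commute of_nat_0_le_iff)
    fix p assume p: "prime p" "p dvd \<Prod>F"
    then obtain p' where p': "p' \<in> F" "p dvd p'" using F(1) by (auto simp: prime_dvd_prod_iff)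
    then have "p = p'" using p(1) F(2) by (simp add: primes_dvd_imp_eq)
    then show "r < p" "p \<in> nonresidue_class" using p'(1) by (auto simp: F_def)
  qed
qed

section \<open>The binomial sum as an iterated difference\<close>

text \<open>
  This equals the integral of \<open>x ^ (r - 1) * (1 + x) ^ n\<close> over the unit interval when \<open>r > 0\<close>. For
  \<open>r = 0\<close> the summand for \<open>k = 0\<close> is \<open>1 / 0 = 0\<close>, and it cancels in the recurrence below.
\<close>

definition shifted_binomial_sum :: "nat \<Rightarrow> nat \<Rightarrow> rat" where
  "shifted_binomial_sum r n = (\<Sum>k\<le>n. of_nat (n choose k) / of_nat (k + r))"

lemma S_eq_shifted_binomial_sum:
  assumes "r > 0"
  shows "S r n = 2 ^ n - of_nat r * shifted_binomial_sum r n"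
proof -
  have "of_nat k / of_nat (k + r) * of_nat (n choose k)
      = (of_nat (n choose k) - of_nat r * (of_nat (n choose k) / of_nat (k + r)) :: rat)" for k
  proof -
    have "x / (x + y) * c = c - y * (c / (x + y))" if "x + y \<noteq> 0" for x y c :: rat
      using that by (simp add: field_simps)
    moreover have "of_nat (k + r) \<noteq> (0 :: rat)" using assms by (simp only: of_nat_eq_0_iff)
    ultimately show ?thesis by (metis of_nat_add)
  qed
  then have "S r n = (\<Sum>k\<le>n. of_nat (n choose k)) - of_nat r * shifted_binomial_sum r n"
    unfolding S_def shifted_binomial_sum_def
    by (simp only: sum_subtractf sum_distrib_left atLeast0AtMost)
  also have "(\<Sum>k\<le>n. of_nat (n choose k)) = (2 ^ n :: rat)"
    by (metis choose_row_sum of_nat_numeral of_nat_power of_nat_sum)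
  finally show ?thesis .
qed

text \<open>
  Pascal's rule, applied to \<open>Suc n\<close> after the summand \<open>k = 0\<close> has been split off.
\<close>

lemma shifted_binomial_sum_Suc:
  "shifted_binomial_sum (Suc r) n = shifted_binomial_sum r (Suc n) - shifted_binomial_sum r n"
proof -
  have "shifted_binomial_sum r (Suc n)
      = 1 / of_nat r + (\<Sum>k\<le>n. of_nat ((n choose Suc k) + (n choose k)) / of_nat (Suc k + r))"
    unfolding shifted_binomial_sum_def by (subst sum.atMost_Suc_shift) (simp add: add.commute)
  also have "\<dots> = (1 / of_nat r + (\<Sum>k\<le>n. of_nat (n choose Suc k) / of_nat (Suc k + r)))
      + (\<Sum>k\<le>n. of_nat (n choose k) / of_nat (Suc k + r))"
    by (simp only: of_nat_add add_divide_distrib sum.distrib add.assoc)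
  also have "1 / of_nat r + (\<Sum>k\<le>n. of_nat (n choose Suc k) / of_nat (Suc k + r))
      = (\<Sum>k\<le>Suc n. of_nat (n choose k) / of_nat (k + r) :: rat)"
    by (subst sum.atMost_Suc_shift) simp
  also have "\<dots> = shifted_binomial_sum r n"
    by (simp add: shifted_binomial_sum_def)
  also have "(\<Sum>k\<le>n. of_nat (n choose k) / of_nat (Suc k + r)) = shifted_binomial_sum (Suc r) n"
    by (simp add: shifted_binomial_sum_def)
  finally show ?thesis by simp
qed

lemma shifted_binomial_sum_1:
  "shifted_binomial_sum 1 n = of_nat (2 ^ (n + 1) - 1) / of_nat (n + 1)"
proof -
  have "of_nat (n choose k) / of_nat (k + 1) = (of_nat (Suc n choose Suc k) / of_nat (n + 1) :: rat)" for k
  proof -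
    have "of_nat (Suc k) * of_nat (Suc n choose Suc k) = (of_nat (Suc n) * of_nat (n choose k) :: rat)"
      by (metis Suc_times_binomial of_nat_mult)
    then show ?thesis by (simp add: field_simps del: binomial_Suc_Suc of_nat_Suc)
  qed
  then have "shifted_binomial_sum 1 n = of_nat (\<Sum>k\<le>n. Suc n choose Suc k) / of_nat (n + 1)"
    by (simp only: shifted_binomial_sum_def sum_divide_distrib of_nat_sum)
  also have "(\<Sum>k\<le>n. Suc n choose Suc k) = 2 ^ (n + 1) - 1"
    using choose_row_sum[of "Suc n"] by (subst (asm) sum.atMost_Suc_shift) simp
  finally show ?thesis .
qed

lemma iterated_difference:
  fixes f :: "nat \<Rightarrow> nat \<Rightarrow> 'a::comm_ring_1"
  assumes "\<And>r n. f (Suc r) n = f r (Suc n) - f r n"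
  shows "f (s + d) n = (\<Sum>i\<le>d. (-1) ^ (d - i) * of_nat (d choose i) * f s (n + i))"
proof (induction d arbitrary: n)
  case 0
  then show ?case by simp
next
  case (Suc d)
  have "f (s + Suc d) n = f (s + d) (Suc n) - f (s + d) n" using assms by simp
  also have "f (s + d) (Suc n) = (\<Sum>i\<le>d. (-1) ^ (d - i) * of_nat (d choose i) * f s (n + Suc i))"
    using Suc.IH[of "Suc n"] by simp
  also have "f (s + d) n = (\<Sum>i\<le>Suc d. (-1) ^ (d - i) * of_nat (d choose i) * f s (n + i))"
    using Suc.IH[of n] by (simp add: binomial_eq_0)
  also have "\<dots> = (-1) ^ d * f s n
      + (\<Sum>i\<le>d. (-1) ^ (d - Suc i) * of_nat (d choose Suc i) * f s (n + Suc i))"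
    by (subst sum.atMost_Suc_shift) simp
  also have "(\<Sum>i\<le>d. (-1) ^ (d - Suc i) * of_nat (d choose Suc i) * f s (n + Suc i))
     = (\<Sum>i\<le>d. - ((-1) ^ (d - i) * of_nat (d choose Suc i) * f s (n + Suc i)))"
  proof (rule sum.cong)
    fix i assume "i \<in> {..d}"
    then consider "i = d" | "d - i = Suc (d - Suc i)" by force
    then show "(-1) ^ (d - Suc i) * of_nat (d choose Suc i) * f s (n + Suc i)
       = - ((-1) ^ (d - i) * of_nat (d choose Suc i) * f s (n + Suc i))"
      by cases (auto simp: binomial_eq_0)
  qed simp
  finally have "f (s + Suc d) n = - ((-1) ^ d * f s n) + (\<Sum>i\<le>d. (-1) ^ (d - i) * of_nat (d choose i) * f s (n + Suc i)
      + (-1) ^ (d - i) * of_nat (d choose Suc i) * f s (n + Suc i))"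
    by (simp add: sum_negf sum.distrib)
  also have "\<dots> = (\<Sum>i\<le>Suc d. (-1) ^ (Suc d - i) * of_nat (Suc d choose i) * f s (n + i))"
    by (subst sum.atMost_Suc_shift) (simp add: algebra_simps)
  finally show ?case .
qed

section \<open>Primes that prevent integrality\<close>

text \<open>
  The fractions \<open>(2 ^ m - 1) / m\<close> with \<open>m\<close> different from \<open>n + i + 1\<close> are cleared by the product \<open>D\<close> of
  their denominators, which is prime to \<open>p\<close> because \<open>p > r\<close> divides at most one of \<open>r\<close> consecutive
  numbers. After multiplication by \<open>D\<close>, the remaining fraction would have to be an integer although
  \<open>p\<close> divides its denominator and no factor of its numerator.
\<close>

lemma S_not_integer:
  assumes p: "prime p" "p > r" and i: "i < r" and dvd: "p dvd n + i + 1"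
    and ndvd: "\<not> p dvd 2 ^ (n + i + 1) - (1::nat)"
  shows "S r n \<notin> \<int>"
proof
  assume "S r n \<in> \<int>"
  define d where "d = r - 1"
  have r: "r = 1 + d" "r > 0" using i by (auto simp: d_def)
  define g :: "nat \<Rightarrow> rat" where "g j = of_nat (2 ^ (n + j + 1) - 1) / of_nat (n + j + 1)" for j
  have F: "shifted_binomial_sum r n = (\<Sum>j\<le>d. (-1) ^ (d - j) * of_nat (d choose j) * g j)"
    unfolding r(1) g_def
    by (subst iterated_difference[of shifted_binomial_sum, OF shifted_binomial_sum_Suc])
      (simp only: shifted_binomial_sum_1)
  define D where "D = (\<Prod>j\<in>{..d} - {i}. n + j + 1)"
  have "of_nat r * shifted_binomial_sum r n \<in> \<int>"
  proof -
    have "of_nat r * shifted_binomial_sum r n = 2 ^ n - S r n"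
      using S_eq_shifted_binomial_sum[OF r(2)] by simp
    then show ?thesis using \<open>S r n \<in> \<int>\<close> by (metis Ints_diff Ints_numeral Ints_power)
  qed
  then have total: "of_nat D * (of_nat r * shifted_binomial_sum r n) \<in> \<int>"
    by (rule Ints_mult[OF Ints_of_nat])
  have other: "of_nat D * g j \<in> \<int>" if "j \<in> {..d} - {i}" for j
  proof -
    have "n + j + 1 dvd D" unfolding D_def by (rule dvd_prodI) (use that in auto)
    then obtain e where e: "D = (n + j + 1) * e" by blast
    have "of_nat (n + j + 1) \<noteq> (0::rat)" by (simp only: of_nat_eq_0_iff)
    then have "of_nat D * g j = of_nat e * of_nat (2 ^ (n + j + 1) - 1)"
      unfolding g_def e of_nat_mult by (simp only: times_divide_eq_right) (simp add: field_simps)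
    then show ?thesis by (metis Ints_of_nat of_nat_mult)
  qed
  have "i \<in> {..d}" using i by (simp add: d_def)
  then have "shifted_binomial_sum r n = (-1) ^ (d - i) * of_nat (d choose i) * g i
     + (\<Sum>j\<in>{..d} - {i}. (-1) ^ (d - j) * of_nat (d choose j) * g j)"
    unfolding F by (subst sum.remove[of _ i]) auto
  then have "of_nat D * (of_nat r * shifted_binomial_sum r n)
     = (-1) ^ (d - i) * (of_nat D * of_nat r * of_nat (d choose i) * g i)
     + (\<Sum>j\<in>{..d} - {i}. of_nat r * (-1) ^ (d - j) * of_nat (d choose j) * (of_nat D * g j))"
    by (simp add: algebra_simps sum_distrib_left)
  moreover have "(\<Sum>j\<in>{..d} - {i}. of_nat r * (-1) ^ (d - j) * of_nat (d choose j) * (of_nat D * g j)) \<in> \<int>"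
    by (intro Ints_sum Ints_mult[OF _ other] Ints_mult Ints_power) auto
  ultimately have "(-1) ^ (d - i) * (of_nat D * of_nat r * of_nat (d choose i) * g i) \<in> \<int>"
    using Ints_diff[OF total, of "\<Sum>j\<in>{..d} - {i}. of_nat r * (-1) ^ (d - j) * of_nat (d choose j) * (of_nat D * g j)"]
    by (simp only: add_diff_cancel_right')
  then have "of_nat D * of_nat r * of_nat (d choose i) * g i \<in> \<int>"
    by (cases "even (d - i)") (auto simp: minus_in_Ints_iff)
  then obtain z where z: "of_nat D * of_nat r * of_nat (d choose i) * g i = of_int z"
    by (auto elim: Ints_cases)
  have "of_nat (n + i + 1) \<noteq> (0::rat)" by (simp only: of_nat_eq_0_iff)
  then have "of_nat (D * r * (d choose i) * (2 ^ (n + i + 1) - 1)) = (of_int z * of_nat (n + i + 1) :: rat)"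
    using z unfolding g_def of_nat_mult by (simp only: times_divide_eq_right divide_eq_eq) simp
  then have "(of_int (int (D * r * (d choose i) * (2 ^ (n + i + 1) - 1))) :: rat) = of_int (z * int (n + i + 1))"
    by simp
  then have "int (D * r * (d choose i) * (2 ^ (n + i + 1) - 1)) = z * int (n + i + 1)"
    by (simp only: of_int_eq_iff)
  then have "int p dvd int (D * r * (d choose i) * (2 ^ (n + i + 1) - 1))"
    using dvd by (metis dvd_mult of_nat_dvd_iff)
  then have "p dvd D * r * (d choose i) * (2 ^ (n + i + 1) - 1)" by (simp only: of_nat_dvd_iff)
  then consider "p dvd D" | "p dvd r" | "p dvd d choose i"
    using ndvd p(1) by (auto simp: prime_dvd_mult_iff)
  then show False
  proof cases
    case 1
    then obtain j where j: "j \<le> d" "j \<noteq> i" "p dvd n + j + 1"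
      using p(1) by (auto simp: D_def prime_dvd_prod_iff)
    have "[n + j + 1 = n + i + 1] (mod p)"
      using j(3) dvd unfolding cong_def by (metis dvd_imp_mod_0)
    then have "[n + 1 + j = n + 1 + i] (mod p)" by (simp only: ac_simps)
    then have "[j = i] (mod p)" by (simp only: cong_add_lcancel_nat)
    moreover have "j < p" "i < p" using j(1) i p(2) r(1) by linarith+
    ultimately show False using j(2) cong_less_modulus_unique_nat by blast
  next
    case 2
    then show False using p(2) r(2) by (auto dest: dvd_imp_le)
  next
    case 3
    have "d choose i dvd fact d"
      using \<open>i \<in> {..d}\<close> by (metis atMost_iff binomial_fact_lemma dvd_triv_right)
    then have "p dvd fact d" using 3 dvd_trans by blast
    then show False using p r by (simp add: prime_dvd_fact_iff)
  qed
qed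

text \<open>
  Take the odd one of \<open>n + 1\<close> and \<open>n + 2\<close>; the hypothesis \<open>r > 1\<close> puts both among the denominators.
\<close>

lemma S_integer_imp_coprime:
  assumes "S r n \<in> \<int>" "r > 1"
    and Q: "\<And>p. prime p \<Longrightarrow> p dvd Q \<Longrightarrow> p > r \<and> p \<in> nonresidue_class"
  shows "coprime (n + 1) Q \<or> coprime (n + 2) Q"
proof -
  define i where "i = (if even n then 0 else 1 :: nat)"
  have "odd (n + i + 1)" "i < r" using assms(2) by (auto simp: i_def)
  have "coprime (n + i + 1) Q"
  proof (rule ccontr)
    assume "\<not> coprime (n + i + 1) Q"
    then obtain p where p: "prime p" "p dvd n + i + 1" "p dvd Q"
      by (metis coprime_iff_gcd_eq_1 gcd_nat.bounded_iff prime_factor_nat)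
    have "\<not> p dvd 2 ^ (n + i + 1) - 1"
      using prime_dvd_mersenne_imp_even[OF p(1)] Q[OF p(1,3)] \<open>odd (n + i + 1)\<close> by blast
    then show False using S_not_integer[OF p(1) _ \<open>i < r\<close> p(2)] Q[OF p(1,3)] assms(1) by blast
  qed
  then show ?thesis by (auto simp: i_def split: if_splits)
qed

section \<open>The density bound\<close>

lemma card_coprime_le:
  assumes "Q > 0"
  shows "card {m \<in> {0<..N}. coprime m Q} \<le> (N div Q + 1) * totient Q"
proof -
  have "N \<le> (N div Q + 1) * Q"
    by (rule le_Suc_div_mult[OF assms])
  then have "card {m \<in> {0<..N}. coprime m Q} \<le> card ({m. coprime m Q} \<inter> {0<..(N div Q + 1) * Q})"
    by (intro card_mono) auto
  also have "\<dots> = (N div Q + 1) * card ({m. coprime m Q} \<inter> {0<..Q})"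
    by (rule card_periodic) (auto simp: coprime_add_self_iff)
  also have "{m. coprime m Q} \<inter> {0<..Q} = totatives Q"
    by (auto simp: totatives_def)
  finally show ?thesis by (simp add: totient_def)
qed

text \<open>
  Each of the two alternatives contributes at most the density of the numbers coprime to \<open>Q\<close>, which is
  at most \<open>\<epsilon>\<close>. The third \<open>\<epsilon>\<close> absorbs the bounded error of an incomplete period for large \<open>x\<close>.
\<close>

lemma upper_density_le_if_sieved:
  assumes "Q > 0" "real (totient Q) \<le> \<epsilon> * real Q" "\<epsilon> > 0"
    and A: "\<And>n. n \<in> A \<Longrightarrow> coprime (n + 1) Q \<or> coprime (n + 2) Q"
  shows "upper_density A \<le> ereal (3 * \<epsilon>)"
  unfolding upper_density_def
proof (rule Limsup_bounded, rule eventually_at_top_linorderI)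
  fix x :: real
  \<comment> \<open>The threshold is where the error \<open>4 * \<epsilon> + 2 * \<phi>(Q)\<close> found below drops under \<open>\<epsilon> * x\<close>.\<close>
  assume x: "x \<ge> max 1 ((4 * \<epsilon> + 2 * totient Q) / \<epsilon>)"
  define N where "N = nat \<lfloor>x\<rfloor>"
  have Nx: "real N \<le> x" using x of_nat_floor[of x] by (simp add: N_def)
  define U where "U = {m \<in> {0<..N + 2}. coprime m Q}"
  have "{n \<in> A. real n \<le> x} \<subseteq> (\<lambda>m. m - 1) ` U \<union> (\<lambda>m. m - 2) ` U"
  proof
    fix n assume n: "n \<in> {n \<in> A. real n \<le> x}"
    then have "n \<le> N" using x by (simp add: N_def le_nat_floor)
    then have "n + 1 \<in> U \<or> n + 2 \<in> U" using A n by (auto simp: U_def)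
    then show "n \<in> (\<lambda>m. m - 1) ` U \<union> (\<lambda>m. m - 2) ` U" by force
  qed
  moreover have fin: "finite U" by (simp add: U_def)
  ultimately have "card {n \<in> A. real n \<le> x} \<le> card ((\<lambda>m. m - 1) ` U \<union> (\<lambda>m. m - 2) ` U)"
    by (intro card_mono) auto
  also have "\<dots> \<le> card U + card U"
    by (rule order_trans[OF card_Un_le add_mono]) (auto intro: card_image_le fin)
  also have "\<dots> \<le> 2 * (((N + 2) div Q + 1) * totient Q)"
    using card_coprime_le[OF assms(1), of "N + 2"] by (simp add: U_def)
  finally have "real (card {n \<in> A. real n \<le> x}) \<le> real (2 * (((N + 2) div Q + 1) * totient Q))"
    by (simp only: of_nat_le_iff)
  also have "\<dots> = 2 * (real ((N + 2) div Q) * totient Q) + 2 * totient Q"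
    by (simp add: algebra_simps)
  also have "real ((N + 2) div Q) * totient Q \<le> (real (N + 2) / Q) * (\<epsilon> * Q)"
    using assms(2) by (intro mult_mono of_nat_div_le_of_nat) auto
  also have "\<dots> = \<epsilon> * real (N + 2)" using assms(1) by simp
  also have "\<dots> \<le> \<epsilon> * (x + 2)"
    using assms(3) Nx by (intro mult_left_mono) auto
  finally have "real (card {n \<in> A. real n \<le> x}) \<le> 2 * \<epsilon> * x + (4 * \<epsilon> + 2 * totient Q)"
    by (simp add: algebra_simps)
  also have "4 * \<epsilon> + 2 * totient Q \<le> \<epsilon> * x"
    using x assms(3) by (simp add: field_simps)
  finally have "real (card {n \<in> A. real n \<le> x}) \<le> 3 * \<epsilon> * x" by simp
  then show "ereal (real (card {n \<in> A. real n \<le> x}) / x) \<le> ereal (3 * \<epsilon>)"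
    using x by (simp add: field_simps)
qed

lemma upper_density_S_integer:
  assumes "r > 1"
  shows "upper_density {n. n > 0 \<and> (\<exists>m::nat. m > 0 \<and> S r n = of_nat m)} \<le> 0"
proof (rule ereal_le_epsilon2)
  fix e :: real
  assume "e > 0"
  then obtain Q where Q: "Q > 0" "\<And>p. prime p \<Longrightarrow> p dvd Q \<Longrightarrow> p > r \<and> p \<in> nonresidue_class"
    "real (totient Q) \<le> (e / 3) * real Q"
    using exists_sieving_modulus[of "e / 3" r] by auto
  have "upper_density {n. n > 0 \<and> (\<exists>m::nat. m > 0 \<and> S r n = of_nat m)} \<le> ereal (3 * (e / 3))"
  proof (rule upper_density_le_if_sieved[OF Q(1,3)])
    show "e / 3 > 0" using \<open>e > 0\<close> by simp
    fix n assume "n \<in> {n. n > 0 \<and> (\<exists>m::nat. m > 0 \<and> S r n = of_nat m)}"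
    then have "S r n \<in> \<int>" by auto
    then show "coprime (n + 1) Q \<or> coprime (n + 2) Q"
      using S_integer_imp_coprime[OF _ assms Q(2)] by blast
  qed
  then show "upper_density {n. n > 0 \<and> (\<exists>m::nat. m > 0 \<and> S r n = of_nat m)} \<le> 0 + ereal e"
    by simp
qed

text \<open>
  Density zero is stronger than every bound of the form \<open>c / r ^ k\<close> with \<open>c > 0\<close>.
\<close>

theorem theorem1p3:
  shows "\<forall>k::real. k > 0 \<longrightarrow> (\<exists>c::real. c > 0 \<and> (\<forall>r::nat. r > 1 \<longrightarrow>
    upper_density {n. n > 0 \<and> (\<exists>m::nat. m > 0 \<and> S r n = of_nat m)} \<le> ereal (c / real r powr k)))"
proof (intro allI impI exI[of _ "1::real"] conjI)
  fix k :: real and r :: nat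
  assume "r > 1"
  have "upper_density {n. n > 0 \<and> (\<exists>m::nat. m > 0 \<and> S r n = of_nat m)} \<le> 0"
    by (rule upper_density_S_integer[OF \<open>r > 1\<close>])
  also have "0 \<le> ereal (1 / real r powr k)" by simp
  finally show "upper_density {n. n > 0 \<and> (\<exists>m::nat. m > 0 \<and> S r n = of_nat m)} \<le> ereal (1 / real r powr k)" .
qed simp

end
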